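(* There exist distributions $\mathcal{D}$ over $\mathbb{R}^2_{\ge0}$ (two items) such that $\mathrm{Rev}(\mathcal{D})/\mathrm{ARev}(\mathcal{D})=\infty$.
   Context: Setting: one seller, one additive buyer, $k$ items; the buyer's value vector $\vec v\in\mathbb{R}^k_{\ge0}$ is drawn from a (possibly correlated) distribution $\mathcal{D}$. A mechanism $M$ is a set of options $(\vec q,p)$ with $\vec q\in[0,1]^k$, $p\in\mathbb{R}$, always containing the null option $(\vec 0,0)$; a buyer with values $\vec v$ selects an option maximizing $\vec v\cdot\vec q-p$ (ties broken arbitrarily; a maximizer is assumed to exist), and $\vec q^M(\vec v),p^M(\vec v)$ denote the allocation and price of the selected option. $\mathrm{Rev}(\mathcal{D},M)=\mathbb{E}_{\vec v\sim\mathcal{D}}[p^M(\vec v)]$, $\mathrm{Rev}(\mathcal{D})=\sup_M \mathrm{Rev}(\mathcal{D},M)$ (possibly $\infty$). The aligned revenue is $\mathrm{ARev}(\mathcal{D},M):=\mathbb{E}_{\vec v\sim\mathcal{D}}[p^M(\vec v)\cdot \mathbf{1}(\vec v \text{ is parallel to } \vec q^M(\vec v))]$ and $\mathrm{ARev}(\mathcal{D}):=\sup_M\mathrm{ARev}(\mathcal{D},M)$. *)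

theory Defs
  imports "HOL-Analysis.Analysis" "HOL-Probability.Probability"
begin

text \<open>Two items: value vectors and allocations live in real^2.
  An option is a pair (q, p) of an allocation q and a price p.\<close>

type_synonym vec2 = "real ^ 2"

definition nonneg_vec :: "vec2 \<Rightarrow> bool" where
  "nonneg_vec v \<longleftrightarrow> (\<forall>i. 0 \<le> v $ i)"

definition mechanism :: "(vec2 \<times> real) set \<Rightarrow> bool" where
  "mechanism Mech \<longleftrightarrow> (0, 0) \<in> Mech \<and>
     (\<forall>(q, p) \<in> Mech. \<forall>i. 0 \<le> q $ i \<and> q $ i \<le> 1)"

text \<open>A selection rule (arbitrary tie-breaking): every buyer type with nonnegative values
  selects an option of the menu maximizing utility v . q - p.\<close>
definition selection :: "(vec2 \<times> real) set \<Rightarrow> (vec2 \<Rightarrow> vec2 \<times> real) \<Rightarrow> bool" where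
  "selection Mech s \<longleftrightarrow> (\<forall>v. nonneg_vec v \<longrightarrow>
     s v \<in> Mech \<and>
     (\<forall>(q, p) \<in> Mech. v \<bullet> q - p \<le> v \<bullet> fst (s v) - snd (s v)))"

definition distribution2 :: "vec2 measure \<Rightarrow> bool" where
  "distribution2 D \<longleftrightarrow> prob_space D \<and> sets D = sets borel \<and> (AE v in D. nonneg_vec v)"

definition eexp :: "vec2 measure \<Rightarrow> (vec2 \<Rightarrow> real) \<Rightarrow> ereal" where
  "eexp D f = enn2ereal (\<integral>\<^sup>+ v. ennreal (max (f v) 0) \<partial>D)
              - enn2ereal (\<integral>\<^sup>+ v. ennreal (max (- f v) 0) \<partial>D)"

text \<open>Admissible (mechanism, selection rule) pairs: measurable selection, and the negative part
  of the price has finite expectation, so that the expected revenue is well defined.\<close>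
definition admissible :: "vec2 measure \<Rightarrow> (vec2 \<times> real) set \<Rightarrow> (vec2 \<Rightarrow> vec2 \<times> real) \<Rightarrow> bool" where
  "admissible D Mech s \<longleftrightarrow> mechanism Mech \<and> selection Mech s \<and> s \<in> borel_measurable D \<and>
     (\<integral>\<^sup>+ v. ennreal (max (- snd (s v)) 0) \<partial>D) < \<infinity>"

definition parallel :: "vec2 \<Rightarrow> vec2 \<Rightarrow> bool" where
  "parallel v q \<longleftrightarrow> (\<exists>c. q = c *\<^sub>R v) \<or> (\<exists>c. v = c *\<^sub>R q)"

definition Rev_mech :: "vec2 measure \<Rightarrow> (vec2 \<Rightarrow> vec2 \<times> real) \<Rightarrow> ereal" where
  "Rev_mech D s = eexp D (\<lambda>v. snd (s v))"

definition ARev_mech :: "vec2 measure \<Rightarrow> (vec2 \<Rightarrow> vec2 \<times> real) \<Rightarrow> ereal" where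
  "ARev_mech D s = eexp D (\<lambda>v. snd (s v) * (if parallel v (fst (s v)) then 1 else 0))"

definition Rev :: "vec2 measure \<Rightarrow> ereal" where
  "Rev D = (SUP (Mech, s) \<in> {(Mech, s). admissible D Mech s}. Rev_mech D s)"

definition ARev :: "vec2 measure \<Rightarrow> ereal" where
  "ARev D = (SUP (Mech, s) \<in> {(Mech, s). admissible D Mech s}. ARev_mech D s)"

end

theory Submission
  imports Defs "HOL-Library.Discrete_Functions"
begin

text \<open>
  The type \<open>V n = t n * (1, \<eta> n)\<close> has probability proportional to \<open>1 / t n\<close>, where \<open>t\<close> grows so
  fast that prices aimed at earlier types are negligible for later ones. Up to summable errors, the
  price paid by type \<open>n\<close> divided by \<open>t n\<close> is then the smallest value of
  \<open>(q n - q j) \<bullet> (1, \<eta> n)\<close> over \<open>j < n\<close>.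

  If \<open>q n = c n * (1, \<eta> n)\<close> and \<open>q j = c j * (1, \<eta> j)\<close> are both aligned, this is at most
  \<open>c n - c j + (\<eta> n)\<^sup>2\<close>. Taking for \<open>j\<close> the previous aligned type, the sum telescopes, so the aligned
  revenue is finite as soon as the squares of \<open>\<eta>\<close> are summable.

  Unaligned allocations may use the full range of the second coordinate and so gain at the scale
  of \<open>\<eta>\<close> rather than of its square. In round \<open>r\<close>, the slope \<open>\<eta>\<close> runs through \<open>N\<close> equidistant points of
  the interval from \<open>0\<close> to \<open>H\<close>, and the utilities \<open>q \<bullet> (1, x)\<close> of the options are the tangents, at these points,
  of the parabola \<open>A + x\<^sup>2 / (2 * H)\<close>. Raising \<open>A\<close> by \<open>H / (2 * N\<^sup>2)\<close> in each round gives every type of the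
  round a gap of that size; \<open>N\<close>, \<open>H\<close>, \<open>A\<close> are \<open>grid_size r\<close>, \<open>max_slope r\<close>, \<open>base_level r\<close>.
  With \<open>N \<approx> r powr (1/6)\<close> and \<open>H = r powr (-5/6)\<close>, the total rise of \<open>A\<close> and
  the sum of the \<open>\<eta>\<^sup>2\<close> converge while the sum of the gaps diverges like the harmonic series.
\<close>


section \<open>Parallel vectors and measurable selections\<close>

lemma inner_vec2: "(v::vec2) \<bullet> w = v $ 1 * w $ 1 + v $ 2 * w $ 2"
  by (simp add: inner_vec_def sum_2)

lemma vec2_eq_iff: "(v::vec2) = w \<longleftrightarrow> v $ 1 = w $ 1 \<and> v $ 2 = w $ 2"
  by (simp add: vec_eq_iff forall_2)

text \<open>Replaces the existential by a polynomial equation, from which measurability is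
  immediate.\<close>

lemma parallel_iff_det: "parallel v q \<longleftrightarrow> v $ 1 * q $ 2 = v $ 2 * q $ 1"
proof
  assume "parallel v q"
  then show "v $ 1 * q $ 2 = v $ 2 * q $ 1"
    by (auto simp: parallel_def)
next
  assume det: "v $ 1 * q $ 2 = v $ 2 * q $ 1"
  show "parallel v q"
  proof (cases "v = 0")
    case True
    then have "v = 0 *\<^sub>R q" by simp
    then show ?thesis unfolding parallel_def by blast
  next
    case False
    have "\<exists>c. q = c *\<^sub>R v"
    proof (cases "v $ 1 = 0")
      case True
      with False have "v $ 2 \<noteq> 0" by (simp add: vec2_eq_iff)
      with True det have "q = (q $ 2 / v $ 2) *\<^sub>R v" by (simp add: vec2_eq_iff)
      then show ?thesis by blast
    next
      case False
      with det have "q = (q $ 1 / v $ 1) *\<^sub>R v" by (simp add: vec2_eq_iff field_simps)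
      then show ?thesis by blast
    qed
    then show ?thesis unfolding parallel_def by blast
  qed
qed

lemma borel_measurable_price_aligned:
  fixes s :: "vec2 \<Rightarrow> vec2 \<times> real"
  assumes s: "s \<in> borel_measurable borel"
  shows "(\<lambda>v. snd (s v) * (if parallel v (fst (s v)) then 1 else 0)) \<in> borel_measurable borel"
proof -
  have [measurable]: "(\<lambda>v. fst (s v) $ i) \<in> borel_measurable borel" "(\<lambda>v. snd (s v)) \<in> borel_measurable borel" for i
    by (rule borel_measurable_continuous_on[OF _ s]; intro continuous_intros)+
  have [measurable]: "(\<lambda>v::vec2. v $ i) \<in> borel_measurable borel" for i
    by (intro borel_measurable_continuous_onI continuous_intros)
  show ?thesis unfolding parallel_iff_det by measurable
qed

text \<open>Ties go to the least list index, which turns the choice into a measurable map to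
  \<open>nat\<close>. The range clause also covers value vectors with negative entries.\<close>

lemma measurable_selection_exists:
  fixes Mech :: "(vec2 \<times> real) set"
  assumes fin: "finite Mech" and ne: "Mech \<noteq> {}"
  obtains s where "selection Mech s" "s \<in> borel_measurable borel" "range s \<subseteq> Mech"
proof -
  obtain xs where xs: "set xs = Mech" using finite_list[OF fin] by blast
  define u :: "vec2 \<Rightarrow> nat \<Rightarrow> real" where "u v i = v \<bullet> fst (xs ! i) - snd (xs ! i)" for v i
  define best where "best v i \<longleftrightarrow> i < length xs \<and> (\<forall>j\<in>{..<length xs}. u v j \<le> u v i)" for v i
  define k where "k v = (LEAST i. best v i)" for v
  have "\<exists>i. best v i" for v
  proof -
    have "length xs > 0" using xs ne by auto
    then have f: "finite (u v ` {..<length xs})" "u v ` {..<length xs} \<noteq> {}" by auto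
    obtain i where "i < length xs" "u v i = Max (u v ` {..<length xs})"
      using Max_in[OF f] by (auto simp: image_iff)
    with f show ?thesis unfolding best_def by (intro exI[of _ i]) auto
  qed
  then have k: "best v (k v)" for v unfolding k_def by (metis LeastI)
  have [measurable]: "(\<lambda>v. u v i) \<in> borel_measurable borel" for i
    unfolding u_def by measurable
  have "k \<in> measurable borel (count_space UNIV)"
    unfolding k_def best_def by measurable
  then have "(\<lambda>v. xs ! k v) \<in> borel_measurable borel"
    by (rule measurable_compose) simp
  moreover have "selection Mech (\<lambda>v. xs ! k v)"
    unfolding selection_def
  proof (intro allI impI conjI)
    fix v
    show "xs ! k v \<in> Mech" using k[of v] xs by (auto simp: best_def)
    show "\<forall>(q, p)\<in>Mech. v \<bullet> q - p \<le> v \<bullet> fst (xs ! k v) - snd (xs ! k v)"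
    proof (clarify)
      fix q p assume "(q, p) \<in> Mech"
      then obtain j where "j < length xs" "xs ! j = (q, p)" using xs by (metis in_set_conv_nth)
      then show "v \<bullet> q - p \<le> v \<bullet> fst (xs ! k v) - snd (xs ! k v)"
        using k[of v] unfolding best_def u_def by force
    qed
  qed
  moreover have "range (\<lambda>v. xs ! k v) \<subseteq> Mech"
    using k xs by (auto simp: best_def)
  ultimately show ?thesis using that by blast
qed

text \<open>
  For \<open>\<gamma> n = 0\<close> the junk value \<open>1 / \<gamma> n = 0\<close> is intended: such an index gets no option of its own
  in the menu.
\<close>

primrec scale :: "(nat \<Rightarrow> real) \<Rightarrow> nat \<Rightarrow> real" where
  "scale \<gamma> 0 = 1"
| "scale \<gamma> (Suc n) = scale \<gamma> n * (4 ^ Suc n + 1 / \<gamma> (Suc n))"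

text \<open>\<open>\<eta> n\<close> is the slope of type \<open>n\<close>, \<open>(a n, b n)\<close>
  its intended allocation, and \<open>\<gamma> n\<close> its guaranteed advantage, per unit of
  scale, over the null option and all earlier allocations. \<open>sum_eta_sq\<close> will cap the
  aligned revenue, \<open>sum_gamma_unbounded\<close> will make the unrestricted one
  infinite.\<close>

locale gap_sequence =
  fixes \<eta> \<gamma> a b :: "nat \<Rightarrow> real" and K :: real
  assumes eta_nonneg: "0 \<le> \<eta> n" and eta_le: "\<eta> n \<le> 1"
    and a_nonneg: "0 \<le> a n" and a_le: "a n \<le> 1"
    and b_nonneg: "0 \<le> b n" and b_le: "b n \<le> 1"
    and gamma_nonneg: "0 \<le> \<gamma> n" and gamma_le: "\<gamma> n \<le> 1"
    and idle: "\<gamma> n = 0 \<Longrightarrow> a n = 0 \<and> b n = 0"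
    and gap_null: "\<gamma> n \<le> a n + \<eta> n * b n"
    and gap: "0 < \<gamma> n \<Longrightarrow> j < n \<Longrightarrow> \<gamma> n \<le> a n - a j + \<eta> n * (b n - b j)"
    and sum_eta_sq: "(\<Sum>n<m. (\<eta> n)\<^sup>2) \<le> K"
    and sum_gamma_unbounded: "\<exists>m. C \<le> (\<Sum>n<m. \<gamma> n)"
begin

section \<open>Rapidly growing scales and the atomic distribution\<close>

abbreviation t :: "nat \<Rightarrow> real" where "t \<equiv> scale \<gamma>"

lemma t_pos: "0 < t n"
  by (induction n) (auto intro!: mult_pos_pos add_pos_nonneg simp: gamma_nonneg)

lemma t_Suc_ge: "4 ^ Suc n * t n \<le> t (Suc n)"
  using t_pos[of n] gamma_nonneg[of "Suc n"] by (simp add: algebra_simps)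

lemma t_mono: "j \<le> n \<Longrightarrow> t j \<le> t n"
proof (rule lift_Suc_mono_le[of t])
  fix n
  have "1 * t n \<le> 4 ^ Suc n * t n"
    using t_pos[of n] by (intro mult_right_mono one_le_power) auto
  with t_Suc_ge[of n] show "t n \<le> t (Suc n)" by simp
qed

lemma t_growth: "j < n \<Longrightarrow> 4 ^ n * t j \<le> t n"
proof (cases n)
  case (Suc m)
  assume "j < n"
  then have "4 ^ n * t j \<le> 4 ^ n * t m" using t_mono[of j m] Suc by simp
  also have "\<dots> \<le> t n" using t_Suc_ge[of m] Suc by simp
  finally show ?thesis .
qed simp

text \<open>This is what the summand \<open>1 / \<gamma> (Suc n)\<close> of \<open>scale\<close>
  buys: however small its gap, a later option costs at least as much as an earlier one.\<close>

lemma t_growth_gamma: "j < n \<Longrightarrow> 0 < \<gamma> n \<Longrightarrow> t j \<le> t n * \<gamma> n"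
proof (cases n)
  case (Suc m)
  assume j: "j < n" and g: "0 < \<gamma> n"
  have "t m * 1 \<le> t m * (4 ^ n * \<gamma> n + 1)"
    using t_pos[of m] g by (intro mult_left_mono) auto
  also have "\<dots> = t n * \<gamma> n" using g Suc by (simp add: field_simps)
  finally show ?thesis using t_mono[of j m] j Suc by simp
qed simp

lemma t_ge: "4 ^ n \<le> t n"
  using t_growth[of 0 n] by (cases n) auto

lemma summable_inverse_t: "summable (\<lambda>n. 1 / t n)"
proof (rule summable_comparison_test)
  show "\<exists>N. \<forall>n\<ge>N. norm (1 / t n) \<le> (1 / 4) ^ n"
    using t_ge t_pos by (auto simp: power_one_over field_simps abs_of_pos)
qed (simp add: summable_geometric)

definition \<kappa> :: real where "\<kappa> = 1 / (\<Sum>n. 1 / t n)"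

lemma kappa_pos: "0 < \<kappa>"
  unfolding \<kappa>_def using suminf_pos[OF summable_inverse_t] t_pos by simp

definition V :: "nat \<Rightarrow> vec2" where "V n = t n *\<^sub>R vector [1, \<eta> n]"

lemma V_nth [simp]: "V n $ 1 = t n" "V n $ 2 = t n * \<eta> n"
  by (simp_all add: V_def)

lemma nonneg_V: "nonneg_vec (V n)"
  using t_pos[of n] eta_nonneg[of n] by (simp add: nonneg_vec_def forall_2)

definition atoms :: "nat pmf" where "atoms = embed_pmf (\<lambda>n. \<kappa> / t n)"

lemma pmf_atoms: "pmf atoms n = \<kappa> / t n"
  unfolding atoms_def
proof (rule pmf_embed_pmf)
  show "0 \<le> \<kappa> / t x" for x using kappa_pos t_pos[of x] by simp
  have pos: "0 < (\<Sum>n. 1 / t n)"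
    using suminf_pos[OF summable_inverse_t] t_pos by simp
  have s: "summable (\<lambda>n. \<kappa> / t n)"
    using summable_mult[OF summable_inverse_t, of \<kappa>] by simp
  have "(\<Sum>n. \<kappa> / t n) = \<kappa> * (\<Sum>n. 1 / t n)"
    using suminf_mult[OF summable_inverse_t, of \<kappa>] by simp
  also have "\<dots> = 1" using pos by (simp add: \<kappa>_def)
  finally show "(\<integral>\<^sup>+x. ennreal (\<kappa> / t x) \<partial>count_space UNIV) = 1"
    using kappa_pos t_pos s
    by (subst nn_integral_count_space_nat, subst suminf_ennreal2) (auto simp: less_imp_le)
qed

definition D :: "vec2 measure" where "D = distr (measure_pmf atoms) borel V"

lemma sets_D [measurable_cong]: "sets D = sets borel"
  by (simp add: D_def)

lemma distribution2_D: "distribution2 D"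
  unfolding distribution2_def
proof (intro conjI sets_D)
  show "prob_space D" unfolding D_def by (rule measure_pmf.prob_space_distr) simp
  have "{v::vec2. nonneg_vec v} = {v. 0 \<le> v $ 1} \<inter> {v. 0 \<le> v $ 2}"
    by (auto simp: nonneg_vec_def forall_2)
  moreover have "closed \<dots>"
    by (intro closed_Int closed_Collect_le continuous_intros)
  ultimately have "{v \<in> space borel. nonneg_vec v} \<in> sets borel" by (simp add: borel_closed)
  then show "AE v in D. nonneg_vec v"
    unfolding D_def by (subst AE_distr_iff) (auto simp: nonneg_V)
qed

lemma nn_integral_D:
  assumes "f \<in> borel_measurable borel"
  shows "(\<integral>\<^sup>+v. f v \<partial>D) = (\<Sum>n. ennreal (\<kappa> / t n) * f (V n))"
  unfolding D_def using assms
  by (simp add: nn_integral_distr nn_integral_measure_pmf pmf_atoms nn_integral_count_space_nat)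

lemma measurable_D: "f \<in> borel_measurable D \<longleftrightarrow> f \<in> borel_measurable borel"
  using measurable_cong_sets[OF sets_D refl] by blast

section \<open>Upper bound on the aligned revenue\<close>

lemma aligned_price_sum_le:
  fixes p :: "nat \<Rightarrow> real" and q :: "nat \<Rightarrow> vec2"
  assumes p_le: "\<And>n. p n \<le> V n \<bullet> q n"
    and q: "\<And>n i. 0 \<le> q n $ i \<and> q n $ i \<le> 1"
    and ic: "\<And>n j. V n \<bullet> q j - p j \<le> V n \<bullet> q n - p n"
  shows "(\<Sum>n<m. if parallel (V n) (q n) then p n / t n else 0) \<le> K + 4"
proof -
  let ?al = "\<lambda>n. parallel (V n) (q n)"
  let ?S = "\<lambda>m. \<Sum>n<m. if ?al n then p n / t n else 0"
  \<comment> \<open>The geometric term pays for the price of an earlier type: at most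
    \<open>2 * t j\<close>, hence at most \<open>2 * t n / 4 ^ n\<close>.\<close>
  let ?E = "\<lambda>m. \<Sum>n<m. (\<eta> n)\<^sup>2 + 2 * (1 / 4) ^ n"
  have q2: "q n $ 2 = q n $ 1 * \<eta> n" if "?al n" for n
    using that t_pos[of n] by (simp add: parallel_iff_det)
  have inner: "V n \<bullet> q j = t n * (q j $ 1 + \<eta> n * q j $ 2)" for n j
    by (simp add: inner_vec2 algebra_simps)
  have p_le2: "p n \<le> 2 * t n" for n
  proof -
    have "q n $ 1 + \<eta> n * q n $ 2 \<le> 1 + 1 * 1"
      using q[of n] eta_le[of n] eta_nonneg[of n] by (intro add_mono mult_mono) auto
    then have "t n * (q n $ 1 + \<eta> n * q n $ 2) \<le> t n * 2"
      using t_pos[of n] by (intro mult_left_mono) auto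
    then show ?thesis using p_le[of n] inner[of n n] by simp
  qed
  \<comment> \<open>Alignment makes the second coordinate \<open>\<eta> n\<close> times the first,
    so it adds only order \<open>(\<eta> n)\<^sup>2\<close> to the value.\<close>
  have own: "q n $ 1 + \<eta> n * q n $ 2 \<le> q n $ 1 + (\<eta> n)\<^sup>2" if "?al n" for n
  proof -
    have "q n $ 1 * (\<eta> n)\<^sup>2 \<le> 1 * (\<eta> n)\<^sup>2" using q[of n 1] by (intro mult_right_mono) auto
    then show ?thesis using q2[OF that] by (simp add: power2_eq_square algebra_simps)
  qed
  have first: "p n / t n \<le> q n $ 1 + (\<eta> n)\<^sup>2" if "?al n" for n
    using p_le[of n] inner[of n n] own[OF that] t_pos[of n]
    by (simp add: divide_le_eq mult.commute) (smt (verit) mult_left_mono)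
  have step: "p n / t n \<le> q n $ 1 - q j $ 1 + (\<eta> n)\<^sup>2 + 2 * (1 / 4) ^ n" if "?al n" "j < n" for n j
  proof -
    have "p n \<le> p j + t n * (q n $ 1 + \<eta> n * q n $ 2) - t n * (q j $ 1 + \<eta> n * q j $ 2)"
      using ic[of n j] inner by simp
    then have "p n / t n \<le> (p j + t n * (q n $ 1 + \<eta> n * q n $ 2) - t n * (q j $ 1 + \<eta> n * q j $ 2)) / t n"
      using t_pos[of n] by (intro divide_right_mono) auto
    also have "\<dots> = p j / t n + (q n $ 1 + \<eta> n * q n $ 2) - (q j $ 1 + \<eta> n * q j $ 2)"
      using t_pos[of n] by (simp add: add_divide_distrib diff_divide_distrib)
    finally have 1: "p n / t n \<le> p j / t n + (q n $ 1 + \<eta> n * q n $ 2) - (q j $ 1 + \<eta> n * q j $ 2)" .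
    have "p j \<le> 2 * (1 / 4) ^ n * t n"
      using order_trans[OF p_le2[of j], of "2 * (t n / 4 ^ n)"] t_growth[OF that(2)]
      by (simp add: power_one_over field_simps)
    then have 2: "p j / t n \<le> 2 * (1 / 4) ^ n" using t_pos[of n] by (simp add: divide_le_eq)
    have 3: "0 \<le> \<eta> n * q j $ 2" using eta_nonneg q by simp
    from 1 2 3 own[OF that(1)] show ?thesis by linarith
  qed
  \<comment> \<open>\<open>l\<close> is the first coordinate at the latest aligned index, or 0 if
    there is none yet; each aligned index replaces it and the sum telescopes.\<close>
  have "\<exists>l. (l = 0 \<or> (\<exists>j<m. ?al j \<and> l = q j $ 1)) \<and> ?S m \<le> l + ?E m" for m
  proof (induction m)
    case 0
    then show ?case by simp
  next
    case (Suc m)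
    then obtain l where l: "l = 0 \<or> (\<exists>j<m. ?al j \<and> l = q j $ 1)" and le: "?S m \<le> l + ?E m"
      by blast
    show ?case
    proof (cases "?al m")
      case True
      have "p m / t m \<le> q m $ 1 - l + (\<eta> m)\<^sup>2 + 2 * (1 / 4) ^ m"
        using l
      proof
        assume "l = 0"
        moreover have "0 \<le> 2 * (1 / 4 :: real) ^ m" by simp
        ultimately show ?thesis using first[OF True] by linarith
      next
        assume "\<exists>j<m. ?al j \<and> l = q j $ 1"
        then show ?thesis using step[OF True] by blast
      qed
      with le True have "?S (Suc m) \<le> q m $ 1 + ?E (Suc m)" by simp
      with True show ?thesis by blast
    next
      case False
      have "?E m \<le> ?E (Suc m)" by simp
      moreover have "?S (Suc m) = ?S m" using False by simp
      ultimately have "?S (Suc m) \<le> l + ?E (Suc m)" using le by linarith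
      with l show ?thesis using less_Suc_eq by blast
    qed
  qed
  then obtain l where l: "l = 0 \<or> (\<exists>j<m. ?al j \<and> l = q j $ 1)" and le: "?S m \<le> l + ?E m"
    by blast
  \<comment> \<open>The total is at most \<open>1 + K + 8 / 3\<close>, rounded up to
    \<open>K + 4\<close>.\<close>
  have "l \<le> 1" using l q by auto
  moreover have "(\<Sum>n<m. (1 / 4 :: real) ^ n) \<le> 4 / 3"
    by (simp add: sum_gp_strict)
  then have "?E m \<le> K + 2 * (4 / 3)"
    using sum_eta_sq[of m] by (simp add: sum.distrib flip: sum_distrib_left)
  ultimately show ?thesis using le by linarith
qed

text \<open>Bounding the positive part of the aligned price suffices, as \<open>eexp\<close> only
  subtracts from it.\<close>

lemma ARev_mech_le:
  assumes adm: "admissible D Mech s"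
  shows "ARev_mech D s \<le> ereal (\<kappa> * (K + 4))"
proof -
  have mech: "mechanism Mech" and sel: "selection Mech s" and "s \<in> borel_measurable borel"
    using adm by (auto simp: admissible_def measurable_D)
  note meas = borel_measurable_price_aligned[OF this(3)]
  have opt: "s v \<in> Mech" "\<And>q p. (q, p) \<in> Mech \<Longrightarrow> v \<bullet> q - p \<le> v \<bullet> fst (s v) - snd (s v)"
    if "nonneg_vec v" for v
    using sel that unfolding selection_def by fastforce+
  have opt_s: "v \<bullet> fst (s w) - snd (s w) \<le> v \<bullet> fst (s v) - snd (s v)"
    if "nonneg_vec v" "nonneg_vec w" for v w
    using opt(2)[OF that(1)] opt(1)[OF that(2)] by simp
  have nonneg0: "nonneg_vec 0" by (simp add: nonneg_vec_def)
  have alloc: "0 \<le> fst (s v) $ i \<and> fst (s v) $ i \<le> 1" if "nonneg_vec v" for v i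
    using mech opt(1)[OF that] unfolding mechanism_def by fastforce
  define q where "q n = fst (s (V n))" for n
  \<comment> \<open>Type \<open>0\<close> picks the cheapest option; measuring prices from there makes subsidies harmless.\<close>
  define p where "p n = snd (s (V n)) - snd (s 0)" for n
  have base: "snd (s 0) \<le> 0"
    using opt(2)[OF nonneg0, of 0 0] mech by (simp add: mechanism_def)
  have p_nonneg: "0 \<le> p n" for n
    using opt_s[OF nonneg0 nonneg_V[of n]] by (simp add: p_def)
  have p_le: "p n \<le> V n \<bullet> q n" for n
  proof -
    have "0 \<le> V n \<bullet> fst (s 0)"
      unfolding inner_vec2 using nonneg_V[of n] alloc[OF nonneg0]
      by (intro add_nonneg_nonneg mult_nonneg_nonneg) (auto simp only: nonneg_vec_def)
    then show ?thesis using opt_s[OF nonneg_V[of n] nonneg0] by (simp add: p_def q_def)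
  qed
  have ic: "V n \<bullet> q j - p j \<le> V n \<bullet> q n - p n" for n j
    using opt_s[OF nonneg_V[of n] nonneg_V[of j]] by (simp add: p_def q_def)
  have q01: "0 \<le> q n $ i \<and> q n $ i \<le> 1" for n i
    using alloc[OF nonneg_V[of n]] by (simp add: q_def)
  let ?f = "\<lambda>v. snd (s v) * (if parallel v (fst (s v)) then 1 else 0)"
  let ?g = "\<lambda>n. if parallel (V n) (q n) then p n / t n else 0"
  have "(\<integral>\<^sup>+v. ennreal (max (?f v) 0) \<partial>D) = (\<Sum>n. ennreal (\<kappa> / t n) * ennreal (max (?f (V n)) 0))"
    by (intro nn_integral_D measurable_compose[OF meas, of "\<lambda>x. ennreal (max x 0)"]) measurable
  also have "\<dots> \<le> (\<Sum>n. ennreal (\<kappa> * ?g n))"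
  proof (rule suminf_le)
    fix n
    have "max (?f (V n)) 0 \<le> (if parallel (V n) (q n) then p n else 0)"
      using base p_nonneg[of n] by (auto simp: q_def p_def)
    then have "\<kappa> / t n * max (?f (V n)) 0 \<le> \<kappa> / t n * (if parallel (V n) (q n) then p n else 0)"
      using kappa_pos t_pos[of n] by (intro mult_left_mono) auto
    then show "ennreal (\<kappa> / t n) * ennreal (max (?f (V n)) 0) \<le> ennreal (\<kappa> * ?g n)"
      using kappa_pos t_pos[of n] by (subst ennreal_mult[symmetric]) (auto intro!: ennreal_leI simp: q_def)
  qed auto
  also have "\<dots> \<le> ennreal (\<kappa> * (K + 4))"
  proof (rule suminf_le_const)
    fix m
    have "(\<Sum>n<m. ennreal (\<kappa> * ?g n)) = ennreal (\<kappa> * (\<Sum>n<m. ?g n))"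
      using kappa_pos t_pos p_nonneg
      by (subst sum_ennreal) (auto simp: sum_distrib_left less_imp_le)
    also have "\<dots> \<le> ennreal (\<kappa> * (K + 4))"
      using aligned_price_sum_le[OF p_le q01 ic] kappa_pos
      by (intro ennreal_leI mult_left_mono) auto
    finally show "(\<Sum>n<m. ennreal (\<kappa> * ?g n)) \<le> ennreal (\<kappa> * (K + 4))" .
  qed simp
  finally have le: "(\<integral>\<^sup>+v. ennreal (max (?f v) 0) \<partial>D) \<le> ennreal (\<kappa> * (K + 4))" .
  have K: "0 \<le> K" using sum_eta_sq[of 0] by simp
  have "ARev_mech D s \<le> enn2ereal (\<integral>\<^sup>+v. ennreal (max (?f v) 0) \<partial>D)"
    unfolding ARev_mech_def eexp_def by (simp add: ereal_diff_le_self)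
  also have "\<dots> \<le> enn2ereal (ennreal (\<kappa> * (K + 4)))"
    using le by (simp add: less_eq_ennreal.rep_eq)
  also have "\<dots> = ereal (\<kappa> * (K + 4))" using kappa_pos K by (simp add: enn2ereal_ennreal)
  finally show ?thesis .
qed

lemma ARev_le: "ARev D \<le> ereal (\<kappa> * (K + 4))"
  unfolding ARev_def by (rule SUP_least) (auto intro: ARev_mech_le)

text \<open>Rules out a negative denominator, which would turn the quotient into minus
  infinity.\<close>

lemma ARev_nonneg: "0 \<le> ARev D"
proof -
  have "admissible D {(0, 0)} (\<lambda>_. (0, 0))"
    by (simp add: admissible_def mechanism_def selection_def)
  moreover have "ARev_mech D (\<lambda>_. (0, 0)) = 0"
    by (simp add: ARev_mech_def eexp_def)
  ultimately show ?thesis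
    unfolding ARev_def by (intro SUP_upper2[of "({(0, 0)}, \<lambda>_. (0, 0))"]) auto
qed

section \<open>Infinite revenue from finite menus\<close>

definition q :: "nat \<Rightarrow> vec2" where "q n = vector [a n, b n]"
text \<open>
  Charging half of the available gap makes type \<open>n\<close> strictly prefer its option to all cheaper ones;
  the options of later types are more expensive, so deviating to them only helps the seller.
\<close>

definition p :: "nat \<Rightarrow> real" where "p n = t n * \<gamma> n / 2"

lemma q_nth [simp]: "q n $ 1 = a n" "q n $ 2 = b n"
  by (simp_all add: q_def)

lemma p_nonneg: "0 \<le> p n"
  using t_pos[of n] gamma_nonneg[of n] by (simp add: p_def)

lemma inner_V_q: "V n \<bullet> q j = t n * (a j + \<eta> n * b j)"
  by (simp add: inner_vec2 algebra_simps)

text \<open>Truncating to finitely many options guarantees maximizers and a measurable selection. An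
  idle index contributes a copy of the null option.\<close>

definition menu :: "nat \<Rightarrow> (vec2 \<times> real) set" where
  "menu m = insert (0, 0) ((\<lambda>n. (q n, p n)) ` {..<m})"

lemma price_ge:
  assumes n: "n < m" and o: "(q', p') \<in> menu m"
    and best: "\<And>q p. (q, p) \<in> menu m \<Longrightarrow> V n \<bullet> q - p \<le> V n \<bullet> q' - p'"
  shows "p n \<le> p'"
proof (cases "\<gamma> n = 0")
  case True
  then show ?thesis using o p_nonneg by (auto simp: menu_def p_def)
next
  case False
  then have g: "0 < \<gamma> n" using gamma_nonneg[of n] by simp
  then have tg: "0 < t n * \<gamma> n" using t_pos[of n] by simp
  have le: "V n \<bullet> q n - p n \<le> V n \<bullet> q' - p'" using best n by (auto simp: menu_def)
  have "t n * \<gamma> n \<le> V n \<bullet> q n"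
    unfolding inner_V_q using gap_null[of n] t_pos[of n] by (intro mult_left_mono) auto
  with tg have util: "0 < V n \<bullet> q n - p n" unfolding p_def by linarith
  from o consider "q' = 0" "p' = 0" | j where "j < m" "q' = q j" "p' = p j"
    by (auto simp: menu_def)
  then show ?thesis
  proof cases
    case 1
    with le util show ?thesis by simp
  next
    case (2 j)
    consider "j < n" | "j = n" | "n < j" by linarith
    then show ?thesis
    proof cases
      case 1
      have "t n * \<gamma> n \<le> t n * (a n - a j + \<eta> n * (b n - b j))"
        using gap[OF g 1] t_pos[of n] by (intro mult_left_mono) auto
      then have "t n * \<gamma> n \<le> V n \<bullet> q n - V n \<bullet> q j"
        by (simp add: inner_V_q algebra_simps)
      \<comment> \<open>Contradiction: by \<open>le\<close> the value difference is at most
        \<open>p n\<close>, half of the gap just derived.\<close>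
      with le 2 tg p_nonneg[of j] show ?thesis by (simp add: p_def)
    next
      case 2
      with \<open>p' = p j\<close> show ?thesis by simp
    next
      case 3
      show ?thesis
      proof (cases "\<gamma> j = 0")
        case True
        then have "V n \<bullet> q' - p' = 0" using 2 idle[of j] by (simp add: inner_V_q p_def)
        with le util show ?thesis by simp
      next
        case False
        \<comment> \<open>The later price is thus at least \<open>t n / 2\<close>, and
          \<open>p n\<close> is at most that because \<open>\<gamma> n \<le> 1\<close>.\<close>
        then have "t n \<le> t j * \<gamma> j" using t_growth_gamma[OF 3] gamma_nonneg[of j] by simp
        moreover have "t n * \<gamma> n \<le> t n"
          using gamma_le[of n] t_pos[of n] by (simp add: mult_left_le)
        ultimately show ?thesis using 2 by (simp add: p_def)
      qed
    qed
  qed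
qed

lemma Rev_ge: "ereal (\<kappa> / 2 * (\<Sum>n<m. \<gamma> n)) \<le> Rev D"
proof -
  have "finite (menu m)" "menu m \<noteq> {}" by (auto simp: menu_def)
  then obtain s where sel: "selection (menu m) s" and meas: "s \<in> borel_measurable borel"
    and ran: "range s \<subseteq> menu m"
    by (rule measurable_selection_exists)
  have nonneg: "0 \<le> snd (s v)" for v
  proof -
    have "s v \<in> menu m" using ran by auto
    then show ?thesis using p_nonneg by (auto simp: menu_def)
  qed
  have [measurable]: "(\<lambda>v. snd (s v)) \<in> borel_measurable borel"
    by (rule borel_measurable_continuous_on[OF _ meas]) (intro continuous_intros)
  have no_subsidy: "(\<integral>\<^sup>+ v. ennreal (max (- snd (s v)) 0) \<partial>D) = 0"
    using nonneg by (simp add: max_def ennreal_neg)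
  have "mechanism (menu m)"
    unfolding mechanism_def menu_def using a_nonneg a_le b_nonneg b_le by (auto simp: forall_2)
  with sel meas no_subsidy have adm: "admissible D (menu m) s"
    by (simp add: admissible_def measurable_D)
  have ge: "p n \<le> snd (s (V n))" if "n < m" for n
  proof (rule price_ge[OF that])
    show "(fst (s (V n)), snd (s (V n))) \<in> menu m" using ran by auto
    show "V n \<bullet> q - p \<le> V n \<bullet> fst (s (V n)) - snd (s (V n))" if "(q, p) \<in> menu m" for q p
      using sel nonneg_V[of n] that unfolding selection_def by fastforce
  qed
  have "ennreal (\<kappa> / 2 * (\<Sum>n<m. \<gamma> n)) = (\<Sum>n<m. ennreal (\<kappa> / t n * p n))"
  proof -
    have eq: "\<kappa> / t n * p n = \<kappa> / 2 * \<gamma> n" for n using t_pos[of n] by (simp add: p_def)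
    show ?thesis unfolding eq using kappa_pos gamma_nonneg
      by (subst sum_ennreal) (auto simp: sum_distrib_left)
  qed
  also have "\<dots> \<le> (\<Sum>n<m. ennreal (\<kappa> / t n) * ennreal (max (snd (s (V n))) 0))"
  proof (rule sum_mono)
    fix n assume "n \<in> {..<m}"
    then have "\<kappa> / t n * p n \<le> \<kappa> / t n * max (snd (s (V n))) 0"
      using ge[of n] kappa_pos t_pos[of n] by (intro mult_left_mono) auto
    then show "ennreal (\<kappa> / t n * p n) \<le> ennreal (\<kappa> / t n) * ennreal (max (snd (s (V n))) 0)"
      using kappa_pos t_pos[of n] by (subst ennreal_mult[symmetric]) (auto intro!: ennreal_leI)
  qed
  also have "\<dots> \<le> (\<Sum>n. ennreal (\<kappa> / t n) * ennreal (max (snd (s (V n))) 0))"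
    by (rule sum_le_suminf) auto
  also have "\<dots> = (\<integral>\<^sup>+v. ennreal (max (snd (s v)) 0) \<partial>D)"
    by (rule nn_integral_D[symmetric]) measurable
  finally have le: "ennreal (\<kappa> / 2 * (\<Sum>n<m. \<gamma> n)) \<le> (\<integral>\<^sup>+v. ennreal (max (snd (s v)) 0) \<partial>D)" .
  have "ereal (\<kappa> / 2 * (\<Sum>n<m. \<gamma> n)) = enn2ereal (ennreal (\<kappa> / 2 * (\<Sum>n<m. \<gamma> n)))"
    using kappa_pos gamma_nonneg by (subst enn2ereal_ennreal) (auto intro!: sum_nonneg mult_nonneg_nonneg)
  also have "\<dots> \<le> Rev_mech D s"
    unfolding Rev_mech_def eexp_def no_subsidy using le by (simp add: less_eq_ennreal.rep_eq zero_ennreal.rep_eq)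
  also have "\<dots> \<le> Rev D"
    unfolding Rev_def using adm by (intro SUP_upper2[of "(menu m, s)"]) auto
  finally show ?thesis .
qed

lemma Rev_infinite: "Rev D = \<infinity>"
proof (rule ereal_top)
  fix C
  obtain m where "2 * C / \<kappa> \<le> (\<Sum>n<m. \<gamma> n)" using sum_gamma_unbounded by blast
  then have "C \<le> \<kappa> / 2 * (\<Sum>n<m. \<gamma> n)" using kappa_pos by (simp add: field_simps)
  then show "ereal C \<le> Rev D" using Rev_ge[of m] by (meson ereal_less_eq(3) order_trans)
qed

theorem Rev_div_ARev: "Rev D / ARev D = \<infinity>"
proof -
  obtain x where "ARev D = ereal x" "0 \<le> x"
    using ARev_nonneg ARev_le by (cases "ARev D") auto
  \<comment> \<open>In \<open>ereal\<close> the inverse of 0 is infinity, so the quotient is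
    infinite for \<open>x = 0\<close> too.\<close>
  then show ?thesis
    by (cases "x = 0") (auto simp: Rev_infinite divide_ereal_def)
qed

end

section \<open>Enumerating rounds by blocks between squares\<close>

lemma sum_lessThan_add:
  fixes f :: "nat \<Rightarrow> 'a::comm_monoid_add"
  shows "(\<Sum>n<m + k. f n) = (\<Sum>n<m. f n) + (\<Sum>i<k. f (m + i))"
  by (induction k) (simp_all add: add.assoc)

text \<open>
  Index \<open>r\<^sup>2 + i\<close> with \<open>i \<le> 2 * r\<close> is position \<open>i\<close> of round \<open>r\<close>; only positions \<open>1, ..., grid_size r\<close>
  carry an option.
\<close>

definition offset :: "nat \<Rightarrow> nat" where "offset n = n - (floor_sqrt n)\<^sup>2"

lemma floor_sqrt_add_offset:
  assumes "i < 2 * r + 1"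
  shows "floor_sqrt (r\<^sup>2 + i) = r" "offset (r\<^sup>2 + i) = i"
proof -
  show *: "floor_sqrt (r\<^sup>2 + i) = r"
    using assms by (intro floor_sqrt_unique) (auto simp: power2_eq_square)
  show "offset (r\<^sup>2 + i) = i" by (simp add: offset_def *)
qed

lemma sum_square_blocks:
  fixes F :: "nat \<Rightarrow> nat \<Rightarrow> 'a::comm_monoid_add"
  shows "(\<Sum>n<R\<^sup>2. F (floor_sqrt n) (offset n)) = (\<Sum>r<R. \<Sum>i<2 * r + 1. F r i)"
proof (induction R)
  case (Suc R)
  have sq: "(Suc R)\<^sup>2 = R\<^sup>2 + (2 * R + 1)" by (simp add: power2_eq_square)
  have "(\<Sum>i<2 * R + 1. F (floor_sqrt (R\<^sup>2 + i)) (offset (R\<^sup>2 + i))) = (\<Sum>i<2 * R + 1. F R i)"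
    by (rule sum.cong) (use floor_sqrt_add_offset in auto)
  with Suc show ?case
    unfolding sq sum_lessThan_add by simp
qed simp

text \<open>Links the order of indices in \<open>gap\<close> to the lexicographic order in which
  \<open>value_gap\<close> compares options.\<close>

lemma block_order:
  assumes "j < n"
  shows "floor_sqrt j < floor_sqrt n \<or> floor_sqrt j = floor_sqrt n \<and> offset j < offset n"
proof -
  have "floor_sqrt j \<le> floor_sqrt n" using assms by (intro mono_floor_sqrt') simp
  moreover have "(floor_sqrt n)\<^sup>2 \<le> n" "(floor_sqrt j)\<^sup>2 \<le> j" by simp_all
  ultimately show ?thesis using assms unfolding offset_def by (cases "floor_sqrt j = floor_sqrt n") auto
qed

section \<open>Growth rates of the round parameters\<close>

definition grid_size :: "nat \<Rightarrow> nat" where "grid_size r = nat \<lceil>real r powr (1 / 6)\<rceil>"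
definition max_slope :: "nat \<Rightarrow> real" where "max_slope r = real r powr (- 5 / 6)"
text \<open>With grid spacing \<open>d = max_slope r / grid_size r\<close>, this is
  \<open>d\<^sup>2 / (2 * max_slope r)\<close>: how far a tangent lies below the parabola at the
  neighbouring grid point.\<close>

definition round_gap :: "nat \<Rightarrow> real" where "round_gap r = max_slope r / (2 * (real (grid_size r))\<^sup>2)"

lemma grid_size_ge: "real r powr (1 / 6) \<le> real (grid_size r)"
  unfolding grid_size_def by linarith

lemma grid_size_pos: "0 < r \<Longrightarrow> 0 < grid_size r"
  unfolding grid_size_def by simp

lemma grid_size_le: "0 < r \<Longrightarrow> real (grid_size r) \<le> 2 * real r powr (1 / 6)"
proof -
  assume "0 < r"
  then have "1 \<le> real r powr (1 / 6)" by (intro ge_one_powr_ge_zero) auto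
  then show ?thesis unfolding grid_size_def by linarith
qed

text \<open>Ensures that positions 1 to \<open>grid_size r\<close> fit into block \<open>r\<close>,
  whose positions run from 0 to \<open>2 * r\<close>.\<close>

lemma grid_size_le_2r: "grid_size r \<le> 2 * r"
proof (cases "r = 0")
  case False
  then have "real r powr (1 / 6) \<le> real r powr 1" by (intro powr_mono) auto
  with grid_size_le[of r] False have "real (grid_size r) \<le> real (2 * r)" by simp
  then show ?thesis by linarith
qed (simp add: grid_size_def)

lemma max_slope_nonneg: "0 \<le> max_slope r"
  and max_slope_pos: "0 < r \<Longrightarrow> 0 < max_slope r"
  and max_slope_le: "max_slope r \<le> 1"
  by (auto simp: max_slope_def powr_minus_divide divide_le_eq ge_one_powr_ge_zero)

lemma max_slope_antimono: "0 < r \<Longrightarrow> r \<le> s \<Longrightarrow> max_slope s \<le> max_slope r"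
  unfolding max_slope_def by (intro powr_mono2') auto

lemma round_gap_nonneg: "0 \<le> round_gap r" and round_gap_pos: "0 < r \<Longrightarrow> 0 < round_gap r"
  using max_slope_nonneg max_slope_pos grid_size_pos by (auto simp: round_gap_def)

lemma round_gap_le_half: "round_gap r \<le> 1 / 2"
proof (cases "r = 0")
  case False
  then have "1 \<le> (real (grid_size r))\<^sup>2" using grid_size_pos[of r] by (simp add: one_le_power)
  then have "max_slope r \<le> (real (grid_size r))\<^sup>2" using max_slope_le[of r] by linarith
  then show ?thesis using grid_size_pos[of r] False by (simp add: round_gap_def divide_le_eq)
qed (simp add: round_gap_def max_slope_def)

text \<open>The exponent is \<open>- 5 / 6 - 2 / 6 = - 7 / 6\<close>, below -1. Hence the levels
  stay bounded.\<close>

lemma summable_round_gap: "summable round_gap"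
proof (rule summable_comparison_test)
  show "summable (\<lambda>r. real r powr (- 7 / 6))" by (simp add: summable_real_powr_iff)
  have "norm (round_gap r) \<le> real r powr (- 7 / 6)" for r
  proof (cases "r = 0")
    case False
    have "(real r powr (1 / 6))\<^sup>2 \<le> (real (grid_size r))\<^sup>2" by (intro power_mono grid_size_ge) simp
    moreover have sq: "(real r powr (1 / 6))\<^sup>2 = real r powr (1 / 3)"
      by (simp add: power2_eq_square flip: powr_add)
    ultimately have "round_gap r \<le> max_slope r / (2 * real r powr (1 / 3))"
      unfolding round_gap_def using max_slope_nonneg[of r] False grid_size_pos[of r] by (intro divide_left_mono) auto
    also have "\<dots> \<le> max_slope r / real r powr (1 / 3)"
      using max_slope_nonneg[of r] False by (intro divide_left_mono) auto
    also have "\<dots> = real r powr (- 7 / 6)" unfolding max_slope_def by (simp flip: powr_diff)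
    finally show ?thesis using round_gap_nonneg[of r] by simp
  qed (simp add: round_gap_def max_slope_def)
  then show "\<exists>M. \<forall>r\<ge>M. norm (round_gap r) \<le> real r powr (- 7 / 6)" by blast
qed

text \<open>The total gap of a round is \<open>max_slope r / (2 * grid_size r)\<close>, of exponent
  \<open>- 5 / 6 - 1 / 6 = - 1\<close>. A second factor 2 absorbs the ceiling in
  \<open>grid_size\<close>.\<close>

lemma grid_size_mult_round_gap_ge: "0 < r \<Longrightarrow> 1 / (4 * real r) \<le> real (grid_size r) * round_gap r"
proof -
  assume r: "0 < r"
  have "1 / (4 * real r) = max_slope r / (4 * real r powr (1 / 6))"
  proof -
    have "max_slope r / real r powr (1 / 6) = real r powr (- 1)" unfolding max_slope_def by (simp flip: powr_diff)
    also have "\<dots> = 1 / real r" using r by (simp add: powr_minus_divide)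
    finally show ?thesis by (simp add: field_simps)
  qed
  also have "\<dots> \<le> max_slope r / (2 * real (grid_size r))"
    using grid_size_le[OF r] max_slope_nonneg[of r] grid_size_pos[OF r] r by (intro divide_left_mono) auto
  also have "\<dots> = real (grid_size r) * round_gap r" using grid_size_pos[OF r] by (simp add: round_gap_def power2_eq_square)
  finally show ?thesis .
qed

lemma grid_size_mult_max_slope_sq_le: "real (grid_size r) * (max_slope r)\<^sup>2 \<le> 2 * real r powr (- 3 / 2)"
proof (cases "r = 0")
  case False
  have "real (grid_size r) * (max_slope r)\<^sup>2 \<le> 2 * real r powr (1 / 6) * (max_slope r)\<^sup>2"
    using grid_size_le[of r] False by (intro mult_right_mono) auto
  also have "\<dots> = 2 * real r powr (- 3 / 2)"
    unfolding max_slope_def power2_eq_square by (simp flip: powr_add)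
  finally show ?thesis .
qed (simp add: max_slope_def)

section \<open>Allocations from tangents of parabolas\<close>

definition top_level :: real where "top_level = 1 + (\<Sum>r. round_gap r)"
text \<open>The start \<open>1 / 2\<close> keeps \<open>alloc1\<close> nonnegative, by
  \<open>slope_sq_le\<close>. Including \<open>s = r\<close> makes the rise into round
  \<open>r\<close> at least \<open>round_gap r\<close>.\<close>

definition base_level :: "nat \<Rightarrow> real" where "base_level r = 1 / 2 + (\<Sum>s\<le>r. round_gap s)"

lemma top_level_ge: "1 \<le> top_level"
  unfolding top_level_def using suminf_nonneg[OF summable_round_gap] round_gap_nonneg by simp

lemma base_level_ge: "1 / 2 \<le> base_level r"
  unfolding base_level_def by (simp add: sum_nonneg round_gap_nonneg)

lemma base_level_le: "base_level r \<le> top_level"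
  using sum_le_suminf[OF summable_round_gap, of "{..r}"] round_gap_nonneg by (simp add: base_level_def top_level_def)

lemma base_level_step: "r < s \<Longrightarrow> base_level r + round_gap s \<le> base_level s"
proof -
  assume "r < s"
  then have "{..r} \<subseteq> {..<s}" by auto
  then have "(\<Sum>u\<le>r. round_gap u) \<le> (\<Sum>u<s. round_gap u)" by (intro sum_mono2) (auto simp: round_gap_nonneg)
  then show ?thesis by (simp add: base_level_def flip: lessThan_Suc_atMost)
qed

definition active :: "nat \<Rightarrow> nat \<Rightarrow> bool" where "active r i \<longleftrightarrow> 1 \<le> i \<and> i \<le> grid_size r"
definition slope :: "nat \<Rightarrow> nat \<Rightarrow> real" where "slope r i = real i * max_slope r / real (grid_size r)"

lemma pos_if_active: "active r i \<Longrightarrow> 0 < r" and grid_size_pos_if_active: "active r i \<Longrightarrow> 0 < grid_size r"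
  by (auto simp: active_def grid_size_def intro: gr0I)

lemma slope_nonneg: "0 \<le> slope r i"
  using max_slope_nonneg by (simp add: slope_def)

lemma slope_le: "active r i \<Longrightarrow> slope r i \<le> max_slope r"
proof -
  assume a: "active r i"
  then have "real i * max_slope r \<le> real (grid_size r) * max_slope r"
    using max_slope_nonneg[of r] by (intro mult_right_mono) (auto simp: active_def)
  then show ?thesis using grid_size_pos_if_active[OF a] by (simp add: slope_def divide_le_eq mult.commute)
qed

lemma sum_active:
  "(\<Sum>i<2 * r + 1. if active r i then c else 0) = real (grid_size r) * c"
proof -
  have "{i. i < 2 * r + 1 \<and> active r i} = {1..grid_size r}"
    using grid_size_le_2r[of r] by (auto simp: active_def)
  then have "(\<Sum>i\<in>{i\<in>{..<2 * r + 1}. active r i}. c) = real (grid_size r) * c" by simp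
  then show ?thesis by (subst (asm) sum.inter_filter) simp_all
qed

text \<open>\<open>alloc1\<close> and \<open>alloc2\<close> are the intercept and slope of the
  tangent at \<open>x = slope r i\<close> to
  \<open>base_level r + x\<^sup>2 / (2 * max_slope r)\<close>, divided by \<open>top_level\<close>
  to fit into the unit interval.\<close>

definition alloc1 :: "nat \<Rightarrow> nat \<Rightarrow> real" where
  "alloc1 r i = (base_level r - (slope r i)\<^sup>2 / (2 * max_slope r)) / top_level"
definition alloc2 :: "nat \<Rightarrow> nat \<Rightarrow> real" where
  "alloc2 r i = real i / real (grid_size r) / top_level"

lemma slope_sq_le:
  assumes "active r i"
  shows "(slope r i)\<^sup>2 / (2 * max_slope r) \<le> 1 / 2"
proof -
  have "(slope r i)\<^sup>2 \<le> (max_slope r)\<^sup>2" using slope_le[OF assms] slope_nonneg by (intro power_mono) auto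
  also have "\<dots> \<le> max_slope r" using max_slope_le[of r] max_slope_nonneg[of r] by (simp add: power2_eq_square mult_left_le)
  finally show ?thesis using max_slope_pos[OF pos_if_active[OF assms]] by (simp add: divide_le_eq)
qed

text \<open>Completing the square: the tangent falls below its parabola by a multiple of the squared
  distance to the point of contact.\<close>

lemma value_eq:
  assumes "active r i"
  shows "alloc1 r i + x * alloc2 r i
    = (base_level r + x\<^sup>2 / (2 * max_slope r) - (x - slope r i)\<^sup>2 / (2 * max_slope r)) / top_level"
proof -
  have h: "0 < max_slope r" "0 < grid_size r" using max_slope_pos pos_if_active grid_size_pos_if_active assms by auto
  then have "real i / real (grid_size r) = slope r i / max_slope r" by (simp add: slope_def)
  then have "alloc1 r i + x * alloc2 r i = (base_level r - (slope r i)\<^sup>2 / (2 * max_slope r) + x * (slope r i / max_slope r)) / top_level"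
    unfolding alloc1_def alloc2_def by (simp add: add_divide_distrib)
  also have "base_level r - (slope r i)\<^sup>2 / (2 * max_slope r) + x * (slope r i / max_slope r)
      = base_level r + x\<^sup>2 / (2 * max_slope r) - (x - slope r i)\<^sup>2 / (2 * max_slope r)"
    using h by (simp add: field_simps power2_eq_square)
  finally show ?thesis .
qed

text \<open>At \<open>slope r i\<close> the own tangent touches its parabola. An earlier round has a
  lower and flatter parabola, with its tangents below it; within the round, the other point of
  contact is at least one grid step away.\<close>

lemma value_gap:
  assumes act: "active r i" and act': "active r' i'" and ord: "r' < r \<or> r' = r \<and> i' < i"
  shows "round_gap r / top_level \<le> alloc1 r i - alloc1 r' i' + slope r i * (alloc2 r i - alloc2 r' i')"
proof -
  let ?x = "slope r i"
  have h: "0 < max_slope r" "0 < max_slope r'" "0 < grid_size r" using max_slope_pos pos_if_active grid_size_pos_if_active act act' by auto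
  have "round_gap r \<le> base_level r + ?x\<^sup>2 / (2 * max_slope r) - (base_level r' + ?x\<^sup>2 / (2 * max_slope r') - (?x - slope r' i')\<^sup>2 / (2 * max_slope r'))"
  proof (cases "r' < r")
    case True
    have "?x\<^sup>2 / (2 * max_slope r') \<le> ?x\<^sup>2 / (2 * max_slope r)"
      using max_slope_antimono[of r' r] True pos_if_active[OF act'] h by (intro divide_left_mono) auto
    moreover have "0 \<le> (?x - slope r' i')\<^sup>2 / (2 * max_slope r')" using h by simp
    ultimately show ?thesis using base_level_step[OF True] by linarith
  next
    case False
    with ord have r: "r' = r" "i' < i" by auto
    have "slope r i - slope r i' = (real i - real i') * (max_slope r / real (grid_size r))"
      by (simp add: slope_def left_diff_distrib diff_divide_distrib)
    moreover have "1 * (max_slope r / real (grid_size r)) \<le> (real i - real i') * (max_slope r / real (grid_size r))"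
      using r h by (intro mult_right_mono) auto
    ultimately have "(max_slope r / real (grid_size r))\<^sup>2 \<le> (?x - slope r i')\<^sup>2"
      using h by (intro power_mono) auto
    then have "(max_slope r / real (grid_size r))\<^sup>2 / (2 * max_slope r) \<le> (?x - slope r i')\<^sup>2 / (2 * max_slope r)"
      using h by (intro divide_right_mono) auto
    moreover have "(max_slope r / real (grid_size r))\<^sup>2 / (2 * max_slope r) = round_gap r"
      using h by (simp add: round_gap_def power2_eq_square)
    ultimately show ?thesis using r by simp
  qed
  then have "round_gap r / top_level \<le> (base_level r + ?x\<^sup>2 / (2 * max_slope r) - (base_level r' + ?x\<^sup>2 / (2 * max_slope r') - (?x - slope r' i')\<^sup>2 / (2 * max_slope r'))) / top_level"
    using top_level_ge by (intro divide_right_mono) auto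
  also have "\<dots> = (alloc1 r i + ?x * alloc2 r i) - (alloc1 r' i' + ?x * alloc2 r' i')"
    unfolding value_eq[OF act] value_eq[OF act'] by (simp add: diff_divide_distrib)
  finally show ?thesis by (simp add: algebra_simps)
qed

lemma alloc1_bounds: "active r i \<Longrightarrow> 0 \<le> alloc1 r i \<and> alloc1 r i \<le> 1"
proof -
  assume act: "active r i"
  have "0 \<le> (slope r i)\<^sup>2 / (2 * max_slope r)" using max_slope_nonneg[of r] by simp
  then have "0 \<le> base_level r - (slope r i)\<^sup>2 / (2 * max_slope r)" "base_level r - (slope r i)\<^sup>2 / (2 * max_slope r) \<le> top_level"
    using slope_sq_le[OF act] base_level_ge[of r] base_level_le[of r] by linarith+
  then show ?thesis using top_level_ge unfolding alloc1_def by simp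
qed

lemma alloc2_bounds: "active r i \<Longrightarrow> 0 \<le> alloc2 r i \<and> alloc2 r i \<le> 1"
proof -
  assume act: "active r i"
  then have "real i / real (grid_size r) \<le> 1" by (simp add: active_def)
  then have "real i / real (grid_size r) \<le> top_level" using top_level_ge by linarith
  then show ?thesis using top_level_ge unfolding alloc2_def by (simp del: divide_divide_eq_left)
qed

lemma value_gap_null:
  assumes act: "active r i"
  shows "round_gap r / top_level \<le> alloc1 r i + slope r i * alloc2 r i"
proof -
  have "round_gap r \<le> base_level r + (slope r i)\<^sup>2 / (2 * max_slope r)"
    using round_gap_le_half[of r] base_level_ge[of r] max_slope_nonneg[of r] by (simp add: add_increasing2)
  then show ?thesis unfolding value_eq[OF act] using top_level_ge by (simp add: divide_right_mono)
qed

section \<open>Assembling the gap sequence\<close>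

lemma sum_harmonic_unbounded: "\<exists>R. C \<le> (\<Sum>r<R. 1 / real r)"
proof (rule ccontr)
  assume "\<nexists>R. C \<le> (\<Sum>r<R. 1 / real r)"
  then have "(\<Sum>r<R. 1 / real r) \<le> C" for R by (meson linear)
  then have "summable (\<lambda>r. 1 / real r)" by (intro summableI_nonneg_bounded[where x = C]) auto
  then show False using not_summable_harmonic[where 'a = real] by (simp add: inverse_eq_divide)
qed


lemma gap_sequence_exists: "\<exists>\<eta> \<gamma> a b K. gap_sequence \<eta> \<gamma> a b K"
proof -
  let ?r = floor_sqrt and ?i = offset
  let ?E = "\<lambda>r i. if active r i then slope r i else 0"
  let ?G = "\<lambda>r i. if active r i then round_gap r / top_level else 0"
  let ?A1 = "\<lambda>r i. if active r i then alloc1 r i else 0"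
  let ?A2 = "\<lambda>r i. if active r i then alloc2 r i else 0"
  let ?P = "\<lambda>r. 2 * real r powr (- 3 / 2)"
  have summ: "summable ?P" by (intro summable_mult) (simp add: summable_real_powr_iff)
  have g_pos: "0 < round_gap r / top_level" if "active r i" for r i
    using round_gap_pos[OF pos_if_active[OF that]] top_level_ge by simp
  have g_le: "round_gap r / top_level \<le> 1" for r
    using round_gap_le_half[of r] top_level_ge by simp
  have "gap_sequence (\<lambda>n. ?E (?r n) (?i n)) (\<lambda>n. ?G (?r n) (?i n))
      (\<lambda>n. ?A1 (?r n) (?i n)) (\<lambda>n. ?A2 (?r n) (?i n)) (\<Sum>r. ?P r)"
  proof
    fix n j m :: nat and C :: real
    show "0 \<le> ?E (?r n) (?i n)" by (simp add: slope_nonneg)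
    show "?E (?r n) (?i n) \<le> 1" using order_trans[OF slope_le max_slope_le] by simp
    show "0 \<le> ?A1 (?r n) (?i n)" "?A1 (?r n) (?i n) \<le> 1" using alloc1_bounds by simp_all
    show "0 \<le> ?A2 (?r n) (?i n)" "?A2 (?r n) (?i n) \<le> 1" using alloc2_bounds by simp_all
    show "0 \<le> ?G (?r n) (?i n)" using g_pos by (simp add: less_imp_le)
    show "?G (?r n) (?i n) \<le> 1" using g_le by simp
    show "?A1 (?r n) (?i n) = 0 \<and> ?A2 (?r n) (?i n) = 0" if "?G (?r n) (?i n) = 0"
      using that g_pos[of "?r n" "?i n"] by (auto split: if_splits)
    show "?G (?r n) (?i n) \<le> ?A1 (?r n) (?i n) + ?E (?r n) (?i n) * ?A2 (?r n) (?i n)"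
      using value_gap_null by simp
    show "?G (?r n) (?i n) \<le> ?A1 (?r n) (?i n) - ?A1 (?r j) (?i j)
        + ?E (?r n) (?i n) * (?A2 (?r n) (?i n) - ?A2 (?r j) (?i j))"
      if "0 < ?G (?r n) (?i n)" "j < n"
    proof -
      have act: "active (?r n) (?i n)" using that(1) by (simp split: if_splits)
      have ord: "?r j < ?r n \<or> ?r j = ?r n \<and> ?i j < ?i n" by (rule block_order[OF that(2)])
      \<comment> \<open>An inactive \<open>j\<close> carries the zero allocation, so the comparison
        reduces to the null option.\<close>
      show ?thesis
        using act value_gap[OF act _ ord] value_gap_null[OF act]
        by (cases "active (?r j) (?i j)") auto
    qed
    show "(\<Sum>n<m. (?E (?r n) (?i n))\<^sup>2) \<le> (\<Sum>r. ?P r)"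
    proof -
      \<comment> \<open>Extending the range to \<open>m\<^sup>2\<close> makes it end at a block
        boundary.\<close>
      have "(\<Sum>n<m. (?E (?r n) (?i n))\<^sup>2) \<le> (\<Sum>n<m\<^sup>2. (?E (?r n) (?i n))\<^sup>2)"
      proof (rule sum_mono2)
        have "m \<le> m\<^sup>2" by (simp add: power2_eq_square)
        then show "{..<m} \<subseteq> {..<m\<^sup>2}" by auto
      qed auto
      also have "\<dots> = (\<Sum>r<m. \<Sum>i<2 * r + 1. (?E r i)\<^sup>2)"
        by (rule sum_square_blocks[where F = "\<lambda>r i. (?E r i)\<^sup>2"])
      also have "\<dots> \<le> (\<Sum>r<m. \<Sum>i<2 * r + 1. if active r i then (max_slope r)\<^sup>2 else 0)"
        by (intro sum_mono) (simp add: power_mono slope_le slope_nonneg)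
      also have "\<dots> = (\<Sum>r<m. real (grid_size r) * (max_slope r)\<^sup>2)" unfolding sum_active ..
      also have "\<dots> \<le> (\<Sum>r<m. ?P r)" by (intro sum_mono grid_size_mult_max_slope_sq_le)
      also have "\<dots> \<le> (\<Sum>r. ?P r)" by (intro sum_le_suminf summ) auto
      finally show ?thesis .
    qed
    show "\<exists>m. C \<le> (\<Sum>n<m. ?G (?r n) (?i n))"
    proof -
      obtain R where R: "4 * top_level * C \<le> (\<Sum>r<R. 1 / real r)" using sum_harmonic_unbounded by blast
      have "C \<le> (\<Sum>r<R. 1 / real r) / (4 * top_level)" using R top_level_ge by (simp add: le_divide_eq mult.commute)
      also have "\<dots> = (\<Sum>r<R. 1 / (4 * real r) / top_level)" by (simp add: sum_divide_distrib mult.commute mult.left_commute)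
      also have "\<dots> \<le> (\<Sum>r<R. real (grid_size r) * (round_gap r / top_level))"
      proof (rule sum_mono)
        fix r
        \<comment> \<open>For \<open>r = 0\<close> the left side is 0, as division by zero yields
          0.\<close>
        have "1 / (4 * real r) \<le> real (grid_size r) * round_gap r"
          using grid_size_mult_round_gap_ge[of r] round_gap_nonneg[of r] by (cases "r = 0") auto
        then have "1 / (4 * real r) / top_level \<le> real (grid_size r) * round_gap r / top_level"
          using top_level_ge by (intro divide_right_mono) auto
        then show "1 / (4 * real r) / top_level \<le> real (grid_size r) * (round_gap r / top_level)" by simp
      qed
      also have "\<dots> = (\<Sum>r<R. \<Sum>i<2 * r + 1. ?G r i)" unfolding sum_active ..
      also have "\<dots> = (\<Sum>n<R\<^sup>2. ?G (?r n) (?i n))" by (rule sum_square_blocks[symmetric])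
      finally show ?thesis by blast
    qed
  qed
  then show ?thesis by blast
qed

theorem corollary3p4:
  shows "\<exists>D. distribution2 D \<and> Rev D / ARev D = \<infinity>"
proof -
  obtain \<eta> \<gamma> a b K where "gap_sequence \<eta> \<gamma> a b K" using gap_sequence_exists by blast
  then interpret gap_sequence \<eta> \<gamma> a b K .
  show ?thesis using distribution2_D Rev_div_ARev by blast
qed

end
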